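(* Let $x_0\in\mathbb R$ and let $a,b,c$ be functions analytic at $x_0$, with $a$ not identically zero. Consider the second order ordinary differential equation $$a(x)y''+b(x)y'+c(x)y=0 .$$ Suppose that $x_0$ is an ordinary point or a regular singular point of this equation. Then every formal solution $\hat y(x)$ (centered at $x_0$) of the equation is convergent.
   Context: A formal solution centered at $x_0$ is a formal power series $\hat y(x)=\sum_{n\ge 0}a_n(x-x_0)^n$ with coefficients $a_n\in\mathbb C$ which satisfies the equation as an identity of formal power series. It is convergent if it has positive radius of convergence. The point $x_0$ is an ordinary point if $a(x_0)\neq 0$ and a singular point if $a(x_0)=0$. A singular point $x_0$ is a regular singular point if $(x-x_0)\frac{b(x)}{a(x)}$ and $(x-x_0)^2\frac{c(x)}{a(x)}$ have finite limits as $x\to x_0$ (equivalently, extend analytically to $x_0$). *)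

theory Defs
  imports "HOL-Complex_Analysis.Complex_Analysis"
begin

text \<open>
  The equation \<open>a(x) y'' + b(x) y' + c(x) y = 0\<close> is represented by its coefficient functions.
  A formal solution centered at \<open>x0\<close> is a formal power series in the variable \<open>x - x0\<close>, so the
  coefficient functions enter through their Taylor series at \<open>x0\<close>.
\<close>

definition formal_solution ::
    "(complex \<Rightarrow> complex) \<Rightarrow> (complex \<Rightarrow> complex) \<Rightarrow> (complex \<Rightarrow> complex) \<Rightarrow>
     complex \<Rightarrow> complex fps \<Rightarrow> bool" where
  "formal_solution a b c x0 y \<longleftrightarrow>
     fps_expansion a x0 * fps_deriv (fps_deriv y) +
     fps_expansion b x0 * fps_deriv y +
     fps_expansion c x0 * y = 0"

definition convergent_fps :: "complex fps \<Rightarrow> bool" where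
  "convergent_fps y \<longleftrightarrow> fps_conv_radius y > 0"

definition ordinary_point :: "(complex \<Rightarrow> complex) \<Rightarrow> complex \<Rightarrow> bool" where
  "ordinary_point a x0 \<longleftrightarrow> a x0 \<noteq> 0"

definition singular_point :: "(complex \<Rightarrow> complex) \<Rightarrow> complex \<Rightarrow> bool" where
  "singular_point a x0 \<longleftrightarrow> a x0 = 0"

definition regular_singular_point ::
    "(complex \<Rightarrow> complex) \<Rightarrow> (complex \<Rightarrow> complex) \<Rightarrow> (complex \<Rightarrow> complex) \<Rightarrow>
     complex \<Rightarrow> bool" where
  "regular_singular_point a b c x0 \<longleftrightarrow>
     singular_point a x0 \<and>
     (\<exists>L. ((\<lambda>x. (x - x0) * (b x / a x)) \<longlongrightarrow> L) (at x0)) \<and>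
     (\<exists>M. ((\<lambda>x. (x - x0)^2 * (c x / a x)) \<longlongrightarrow> M) (at x0))"

text \<open>
  A function analytic at \<open>x0\<close> matters only near \<open>x0\<close>, so ``not identically zero'' refers to the
  germ. A total function with zero germ at \<open>x0\<close> may be nonzero elsewhere, and then the quotients
  above would be \<open>0\<close> near \<open>x0\<close> by the convention \<open>z / 0 = 0\<close>.
\<close>

definition identically_zero_near :: "(complex \<Rightarrow> complex) \<Rightarrow> complex \<Rightarrow> bool" where
  "identically_zero_near f x0 \<longleftrightarrow> (\<forall>\<^sub>F x in nhds x0. f x = 0)"

end

theory Submission
  imports Defs
begin

text \<open>
  At an ordinary point as well as at a regular singular point the quotients
  \<open>(x - x0) b / a\<close> and \<open>(x - x0)\<^sup>2 c / a\<close> have removable singularities; let \<open>P\<close>, \<open>Q\<close> be their Taylor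
  series. Cancelling the nonzero series of \<open>a\<close> turns the equation into
  \<open>X\<^sup>2 y'' + P X y' + Q y = 0\<close>, that is,
  \<open>(n (n - 1) + P\<^sub>0 n + Q\<^sub>0) y\<^sub>n = - (\<Sum>k<n. (k P\<^sub>n\<^sub>-\<^sub>k + Q\<^sub>n\<^sub>-\<^sub>k) y\<^sub>k)\<close>.
  If \<open>|P\<^sub>j|, |Q\<^sub>j| \<le> M R\<^sup>j\<close>, the left factor is eventually at least \<open>M n\<close> in modulus, and
  induction gives \<open>|y\<^sub>n| \<le> K (2 R)\<^sup>n\<close>.
\<close>

text \<open>At a point \<open>r\<close> strictly inside the disc of convergence the terms of the
  series tend to 0 and are therefore bounded; this gives \<open>M\<close>, with
  \<open>R = 1 / r\<close>.\<close>

lemma fps_conv_radius_pos_imp_geometric_bound: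
  fixes F :: "complex fps"
  assumes "fps_conv_radius F > 0"
  obtains M R :: real where "M > 0" "R > 0" "\<And>n. norm (fps_nth F n) \<le> M * R ^ n"
proof -
  obtain r :: real where r: "r > 0" "ereal r < fps_conv_radius F"
    using assms ereal_dense2[of 0 "fps_conv_radius F"] by (auto simp: zero_ereal_def)
  have "summable (\<lambda>n. norm (fps_nth F n * of_real r ^ n))"
    using r by (intro abs_summable_in_conv_radius) (auto simp: fps_conv_radius_def)
  hence "Bseq (\<lambda>n. norm (fps_nth F n * of_real r ^ n))"
    by (intro convergent_imp_Bseq convergentI[OF summable_LIMSEQ_zero])
  then obtain M where M: "M > 0" "\<And>n. norm (fps_nth F n * of_real r ^ n) \<le> M"
    by (auto elim!: BseqE)
  show thesis
  proof (rule that)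
    show "norm (fps_nth F n) \<le> M * (1 / r) ^ n" for n
      using M(2)[of n] r by (simp add: norm_mult norm_power field_simps)
  qed (use M r in auto)
qed

lemma fps_conv_radius_posI:
  fixes F :: "complex fps"
  assumes "S > 0" "\<And>n. norm (fps_nth F n) \<le> K * S ^ n"
  shows "fps_conv_radius F > 0"
proof -
  \<comment> \<open>The point \<open>1 / (2 * S)\<close> lies at half the radius
    \<open>1 / S\<close> suggested by the bound, so a geometric series of ratio 1/2
    dominates.\<close>
  have "summable (\<lambda>n. fps_nth F n * of_real (1 / (2 * S)) ^ n)"
  proof (rule summable_comparison_test')
    show "summable (\<lambda>n. K * (1 / 2) ^ n)"
      by (intro summable_mult summable_geometric) auto
    show "norm (fps_nth F n * of_real (1 / (2 * S)) ^ n) \<le> K * (1 / 2) ^ n" for n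
    proof -
      have "norm (fps_nth F n * of_real (1 / (2 * S)) ^ n) = norm (fps_nth F n) / (2 * S) ^ n"
        using assms(1) by (simp add: norm_mult norm_power norm_divide power_divide)
      also have "\<dots> \<le> K * S ^ n / (2 * S) ^ n"
        using assms by (intro divide_right_mono) auto
      also have "\<dots> = K * (1 / 2) ^ n"
        using assms(1) by (simp add: power_mult_distrib power_divide)
      finally show ?thesis .
    qed
  qed
  hence "ereal (norm (of_real (1 / (2 * S)) :: complex)) \<le> fps_conv_radius F"
    unfolding fps_conv_radius_def by (rule conv_radius_geI)
  moreover have "0 < ereal (norm (of_real (1 / (2 * S)) :: complex))"
    using assms(1) by simp
  ultimately show ?thesis by (rule less_le_trans[rotated])
qed

text \<open>The finite limit makes the singularity of \<open>g / a\<close> removable, and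
  \<open>P\<close> is the Taylor series of the extension. The conclusion is a product because the
  series of \<open>a\<close> is not a unit when \<open>a z = 0\<close>.\<close>

lemma fps_expansion_removable_quotient:
  assumes g: "g analytic_on {z}" and a: "a analytic_on {z}"
    and nz: "\<not> identically_zero_near a z"
    and lim: "((\<lambda>x. g x / a x) \<longlongrightarrow> L) (at z)"
  obtains P where "fps_conv_radius P > 0" "fps_expansion g z = P * fps_expansion a z"
proof -
  have ev: "eventually (\<lambda>x. a x \<noteq> 0) (at z)"
  proof (rule non_zero_neighbour)
    show "isolated_singularity_at a z" "not_essential a z"
      using a by (auto intro: isolated_singularity_at_analytic not_essential_analytic)
    \<comment> \<open>If \<open>a\<close> vanished on a punctured neighbourhood, continuity would
      give \<open>a z = 0\<close> as well, so the germ of \<open>a\<close> would be zero.\<close>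
    show "\<exists>\<^sub>F x in at z. a x \<noteq> 0"
    proof (rule ccontr)
      assume "\<not> (\<exists>\<^sub>F x in at z. a x \<noteq> 0)"
      hence 0: "eventually (\<lambda>x. a x = 0) (at z)" by (simp add: frequently_def)
      have "(a \<longlongrightarrow> a z) (at z)"
        using a by (simp add: analytic_at_imp_isCont isContD)
      moreover have "(a \<longlongrightarrow> 0) (at z)" using 0 by (rule tendsto_eventually)
      ultimately have "a z = 0" using LIM_unique by blast
      with 0 have "eventually (\<lambda>x. a x = 0) (nhds z)"
        by (auto simp: eventually_at_filter elim!: eventually_mono)
      with nz show False by (simp add: identically_zero_near_def)
    qed
  qed
  define h where "h = (\<lambda>x. if x = z then L else g x / a x)"
  have h: "h analytic_on {z}"
    unfolding h_def
  proof (rule removable_singularity'[OF _ lim])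
    show "isolated_singularity_at (\<lambda>x. g x / a x) z"
      using a g by (intro isolated_singularity_at_divide isolated_singularity_at_analytic
          not_essential_analytic)
  qed
  have at: "eventually (\<lambda>x. h x * a x = g x) (at z)"
    using ev by (auto simp: h_def eventually_at_filter elim!: eventually_mono)
  \<comment> \<open>At \<open>z\<close> itself the definition of \<open>h\<close> does not yield
    \<open>h z * a z = g z\<close>, since \<open>a z\<close> may be 0. Both sides are continuous and
    agree on a punctured neighbourhood, so their values at \<open>z\<close> agree too.\<close>
  have "((\<lambda>x. h x * a x) \<longlongrightarrow> h z * a z) (at z)"
    using a h by (intro tendsto_mult) (auto simp: analytic_at_imp_isCont isContD)
  hence "(g \<longlongrightarrow> h z * a z) (at z)"
    using tendsto_cong[OF at] by simp
  moreover have "(g \<longlongrightarrow> g z) (at z)"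
    using g by (simp add: analytic_at_imp_isCont isContD)
  ultimately have "h z * a z = g z"
    using LIM_unique by blast
  with at have nhds: "eventually (\<lambda>x. h x * a x = g x) (nhds z)"
    by (auto simp: eventually_at_filter elim!: eventually_mono)
  have H: "(\<lambda>x. h (z + x)) has_fps_expansion fps_expansion h z"
    by (rule analytic_at_imp_has_fps_expansion[OF h])
  have "(\<lambda>x. h (z + x) * a (z + x)) has_fps_expansion fps_expansion h z * fps_expansion a z"
    by (intro has_fps_expansion_mult H analytic_at_imp_has_fps_expansion a)
  also have "?this \<longleftrightarrow> (\<lambda>x. g (z + x)) has_fps_expansion fps_expansion h z * fps_expansion a z"
    using nhds by (intro has_fps_expansion_cong) (auto simp: nhds_to_0' eventually_filtermap)
  finally have "fps_expansion g z = fps_expansion h z * fps_expansion a z"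
    using fps_expansion_unique_complex[OF analytic_at_imp_has_fps_expansion[OF g]] by simp
  with H show thesis
    by (intro that) (auto simp: has_fps_expansion_def)
qed

lemma fps_expansion_shift_power_mult:
  assumes "f analytic_on {z}"
  shows "fps_expansion (\<lambda>x. (x - z) ^ m * f x) z = fps_X ^ m * fps_expansion f z"
proof -
  have "(\<lambda>x. (x - z) ^ m * f x) analytic_on {z}"
    using assms by (intro analytic_intros)
  from analytic_at_imp_has_fps_expansion[OF this]
  have "(\<lambda>x. x ^ m * f (z + x)) has_fps_expansion fps_expansion (\<lambda>x. (x - z) ^ m * f x) z"
    by simp
  moreover have "(\<lambda>x. x ^ m * f (z + x)) has_fps_expansion fps_X ^ m * fps_expansion f z"
    by (intro has_fps_expansion_mult has_fps_expansion_fps_X_power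
        analytic_at_imp_has_fps_expansion assms)
  ultimately show ?thesis
    by (rule fps_expansion_unique_complex)
qed

text \<open>\<open>X d/dX\<close> multiplies the \<open>n\<close>-th coefficient by
  \<open>n\<close>, and \<open>X^2 d^2/dX^2\<close> multiplies it by \<open>n (n - 1)\<close>, so
  comparing coefficients involves no index shift in \<open>y\<close>. The \<open>k = n\<close> terms
  of the convolutions go to the left, where the factor is the indicial polynomial at
  \<open>n\<close>.\<close>

lemma Fuchs_normal_form_recurrence:
  fixes P Q y :: "complex fps"
  assumes "fps_X ^ 2 * fps_deriv (fps_deriv y) + P * (fps_X * fps_deriv y) + Q * y = 0"
  shows "(of_nat n * (of_nat n - 1) + of_nat n * fps_nth P 0 + fps_nth Q 0) * fps_nth y n =
    - (\<Sum>k<n. (of_nat k * fps_nth P (n - k) + fps_nth Q (n - k)) * fps_nth y k)"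
proof -
  have X: "fps_nth (fps_X * fps_deriv y) k = of_nat k * fps_nth y k" for k
    by (cases k) auto
  have X2: "fps_nth (fps_X ^ 2 * fps_deriv (fps_deriv y)) n
      = of_nat n * (of_nat n - 1) * fps_nth y n"
  proof (cases "n < 2")
    case True
    hence "n = 0 \<or> n = 1" by auto
    thus ?thesis by (auto simp: fps_X_power_mult_nth)
  next
    case False
    then obtain m where "n = Suc (Suc m)"
      by (metis One_nat_def less_2_cases_iff not0_implies_Suc)
    thus ?thesis unfolding fps_X_power_mult_nth by (simp add: algebra_simps)
  qed
  have set: "{0..n} = insert n {..<n}" by auto
  \<comment> \<open>The factors are swapped so that the convolution index \<open>k\<close> belongs
    to \<open>y\<close>, and \<open>n - k\<close> to \<open>P\<close> and \<open>Q\<close>.\<close>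
  have "0 = fps_nth (fps_X ^ 2 * fps_deriv (fps_deriv y) + (fps_X * fps_deriv y) * P + y * Q) n"
    using assms by (simp add: mult.commute)
  also have "\<dots> = of_nat n * (of_nat n - 1) * fps_nth y n
      + (\<Sum>k=0..n. (of_nat k * fps_nth P (n - k) + fps_nth Q (n - k)) * fps_nth y k)"
    unfolding fps_add_nth X2 fps_mult_nth[of _ P] fps_mult_nth[of _ Q] X
    by (simp add: sum.distrib algebra_simps)
  finally show ?thesis
    unfolding set by (simp add: algebra_simps eq_neg_iff_add_eq_0)
qed

text \<open>The indicial polynomial may vanish at some \<open>n\<close>, and there the recurrence
  does not determine the coefficient of \<open>y\<close>. It grows quadratically, so this happens
  only for small \<open>n\<close>, and those coefficients are absorbed into the constant
  \<open>K\<close>.\<close>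

lemma Fuchs_normal_form_conv_radius_pos:
  fixes P Q y :: "complex fps"
  assumes eq: "fps_X ^ 2 * fps_deriv (fps_deriv y) + P * (fps_X * fps_deriv y) + Q * y = 0"
    and P: "fps_conv_radius P > 0" and Q: "fps_conv_radius Q > 0"
  shows "fps_conv_radius y > 0"
proof -
  obtain M1 R1 where 1: "M1 > 0" "R1 > 0" "\<And>n. norm (fps_nth P n) \<le> M1 * R1 ^ n"
    using fps_conv_radius_pos_imp_geometric_bound[OF P] by blast
  obtain M2 R2 where 2: "M2 > 0" "R2 > 0" "\<And>n. norm (fps_nth Q n) \<le> M2 * R2 ^ n"
    using fps_conv_radius_pos_imp_geometric_bound[OF Q] by blast
  define M where "M = max M1 M2"
  define R where "R = max R1 R2"
  have M: "M > 0" and R: "R > 0" using 1 2 by (auto simp: M_def R_def)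
  have Pb: "norm (fps_nth P n) \<le> M * R ^ n" and Qb: "norm (fps_nth Q n) \<le> M * R ^ n" for n
  proof -
    have "M1 * R1 ^ n \<le> M * R ^ n" "M2 * R2 ^ n \<le> M * R ^ n"
      using 1 2 by (auto simp: M_def R_def intro!: mult_mono power_mono)
    with 1(3)[of n] 2(3)[of n]
    show "norm (fps_nth P n) \<le> M * R ^ n" "norm (fps_nth Q n) \<le> M * R ^ n" by linarith+
  qed
  \<comment> \<open>For \<open>n\<close> at least \<open>N\<close>, \<open>n (n - 1)\<close> is at
    least \<open>3 M n\<close>. The two lower-order terms of the indicial polynomial cost at most
    \<open>M n\<close> each, which leaves \<open>M n\<close>.\<close>
  define N where "N = Suc (nat \<lceil>3 * M + 1\<rceil>)"
  \<comment> \<open>Each summand is at most the sum, so the claimed bound holds for all indices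
    below \<open>N\<close>.\<close>
  define K where "K = (\<Sum>k<N. norm (fps_nth y k) / (2 * R) ^ k)"
  have K: "K \<ge> 0" using R by (auto simp: K_def intro!: sum_nonneg)
  have "norm (fps_nth y n) \<le> K * (2 * R) ^ n" for n
  proof (induction n rule: less_induct)
    case (less n)
    show ?case
    proof (cases "n < N")
      case True
      have "norm (fps_nth y n) / (2 * R) ^ n \<le> K"
        unfolding K_def using True R by (intro member_le_sum) auto
      thus ?thesis using R by (simp add: field_simps)
    next
      case False
      hence n: "real n \<ge> 3 * M + 1" "real n \<ge> 1" unfolding N_def by linarith+
      define D where "D = of_nat n * (of_nat n - 1) + of_nat n * fps_nth P 0 + fps_nth Q 0"
      have "norm (of_nat n * (of_nat n - 1) :: complex) = real n * (real n - 1)"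
      proof -
        have "(of_nat n * (of_nat n - 1) :: complex) = of_real (real n * (real n - 1))" by simp
        also have "norm \<dots> = real n * (real n - 1)"
          unfolding norm_of_real using n by (intro abs_of_nonneg) simp
        finally show ?thesis .
      qed
      moreover have "norm (of_nat n * fps_nth P 0) \<le> real n * M"
        using Pb[of 0] by (auto simp: norm_mult intro!: mult_left_mono)
      moreover have "norm (fps_nth Q 0) \<le> real n * M"
        using order_trans[OF Qb[of 0]] mult_right_mono[OF n(2), of M] M by simp
      moreover have "norm D \<ge> norm (of_nat n * (of_nat n - 1) :: complex)
          - norm (of_nat n * fps_nth P 0) - norm (fps_nth Q 0)"
        using norm_diff_ineq[of "of_nat n * (of_nat n - 1) + of_nat n * fps_nth P 0" "fps_nth Q 0"]
          norm_diff_ineq[of "of_nat n * (of_nat n - 1)" "of_nat n * fps_nth P 0"]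
        unfolding D_def by linarith
      moreover have "real n * (real n - 1) \<ge> real n * (3 * M)"
        using n by (intro mult_left_mono) auto
      ultimately have D: "norm D \<ge> real n * M" by (simp add: algebra_simps)
      have "real n * M * norm (fps_nth y n) \<le> norm (D * fps_nth y n)"
        using D by (simp add: norm_mult mult_right_mono)
      also have "\<dots> = norm (\<Sum>k<n. (of_nat k * fps_nth P (n - k) + fps_nth Q (n - k)) * fps_nth y k)"
        unfolding D_def Fuchs_normal_form_recurrence[OF eq] by (rule norm_minus_cancel)
      \<comment> \<open>The ratio \<open>2 * R\<close> instead of \<open>R\<close> pays off here:
        \<open>R ^ (n - k) * (2 * R) ^ k = R ^ n * 2 ^ k\<close>, and these sum to less than
        \<open>R ^ n * 2 ^ n\<close>. The prefactor \<open>n * M\<close> then cancels against the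
        lower bound for \<open>D\<close>.\<close>
      also have "\<dots> \<le> (\<Sum>k<n. real n * M * K * R ^ n * 2 ^ k)"
      proof (rule sum_norm_le)
        fix k assume "k \<in> {..<n}"
        hence k: "k < n" by simp
        have "norm (of_nat k * fps_nth P (n - k) + fps_nth Q (n - k))
            \<le> real k * norm (fps_nth P (n - k)) + norm (fps_nth Q (n - k))"
          using norm_triangle_ineq[of "of_nat k * fps_nth P (n - k)"] by (simp add: norm_mult)
        also have "\<dots> \<le> real k * (M * R ^ (n - k)) + M * R ^ (n - k)"
          by (intro add_mono mult_left_mono Pb Qb) auto
        also have "\<dots> = (real k + 1) * (M * R ^ (n - k))" by (simp add: algebra_simps)
        \<comment> \<open>As \<open>k < n\<close>, \<open>k + 1\<close> is at most \<open>n\<close>;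
          this absorbs the contribution of \<open>Q\<close>.\<close>
        also have "\<dots> \<le> real n * (M * R ^ (n - k))"
          using k M R by (intro mult_right_mono) auto
        finally have "norm ((of_nat k * fps_nth P (n - k) + fps_nth Q (n - k)) * fps_nth y k)
            \<le> (real n * (M * R ^ (n - k))) * (K * (2 * R) ^ k)"
          unfolding norm_mult using less.IH[OF k] M R by (intro mult_mono) auto
        also have "\<dots> = real n * M * K * (R ^ (n - k) * R ^ k) * 2 ^ k"
          by (simp add: power_mult_distrib)
        also have "R ^ (n - k) * R ^ k = R ^ n"
          using k by (simp flip: power_add)
        finally show "norm ((of_nat k * fps_nth P (n - k) + fps_nth Q (n - k)) * fps_nth y k)
            \<le> real n * M * K * R ^ n * 2 ^ k" .
      qed
      also have "\<dots> = real n * M * K * R ^ n * (2 ^ n - 1)"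
        by (simp add: geometric_sum flip: sum_distrib_left)
      also have "\<dots> \<le> real n * M * K * R ^ n * 2 ^ n"
        using M K R by (intro mult_left_mono) auto
      also have "\<dots> = real n * M * (K * (2 * R) ^ n)"
        by (simp add: power_mult_distrib)
      finally show ?thesis
        by (rule mult_left_le_imp_le) (use n M in auto)
    qed
  qed
  thus ?thesis using R by (intro fps_conv_radius_posI[of "2 * R"]) auto
qed

text \<open>At an ordinary point both quotients are continuous with limit 0, so the two kinds of
  points can be treated alike from here on.\<close>

lemma ordinary_or_regular_singular_imp_tendsto:
  assumes "a analytic_on {z}" "b analytic_on {z}" "c analytic_on {z}"
    and "ordinary_point a z \<or> regular_singular_point a b c z"
  shows "\<exists>L. ((\<lambda>x. (x - z) * (b x / a x)) \<longlongrightarrow> L) (at z)"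
    and "\<exists>L. ((\<lambda>x. (x - z)^2 * (c x / a x)) \<longlongrightarrow> L) (at z)"
proof -
  have lims: "((\<lambda>x. (x - z) * (b x / a x)) \<longlongrightarrow> (z - z) * (b z / a z)) (at z)"
    "((\<lambda>x. (x - z)^2 * (c x / a x)) \<longlongrightarrow> (z - z)^2 * (c z / a z)) (at z)" if "a z \<noteq> 0"
    using assms(1-3) that by (intro tendsto_intros isContD analytic_at_imp_isCont; simp)+
  show "\<exists>L. ((\<lambda>x. (x - z) * (b x / a x)) \<longlongrightarrow> L) (at z)"
    "\<exists>L. ((\<lambda>x. (x - z)^2 * (c x / a x)) \<longlongrightarrow> L) (at z)"
    using assms(4) lims unfolding ordinary_point_def regular_singular_point_def by blast+
qed

theorem theorem2:
  fixes x0 :: real and a b c :: "complex \<Rightarrow> complex" and y :: "complex fps"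
  assumes "a analytic_on {complex_of_real x0}"
    and "b analytic_on {complex_of_real x0}"
    and "c analytic_on {complex_of_real x0}"
    and "\<not> identically_zero_near a (complex_of_real x0)"
    and "ordinary_point a (complex_of_real x0) \<or>
         regular_singular_point a b c (complex_of_real x0)"
    and "formal_solution a b c (complex_of_real x0) y"
  shows "convergent_fps y"
proof -
  define z where "z = complex_of_real x0"
  note asm = assms[folded z_def]
  define A where "A = fps_expansion a z"
  obtain L where "((\<lambda>x. (x - z) * (b x / a x)) \<longlongrightarrow> L) (at z)"
    using ordinary_or_regular_singular_imp_tendsto(1)[OF asm(1-3,5)] by blast
  hence L: "((\<lambda>x. (x - z) ^ 1 * b x / a x) \<longlongrightarrow> L) (at z)" by simp
  obtain L' where "((\<lambda>x. (x - z)^2 * (c x / a x)) \<longlongrightarrow> L') (at z)"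
    using ordinary_or_regular_singular_imp_tendsto(2)[OF asm(1-3,5)] by blast
  hence L': "((\<lambda>x. (x - z)^2 * c x / a x) \<longlongrightarrow> L') (at z)" by simp
  have "(\<lambda>x. (x - z) ^ 1 * b x) analytic_on {z}" "(\<lambda>x. (x - z)^2 * c x) analytic_on {z}"
    using asm(2,3) by (auto intro!: analytic_intros)
  note quotients = fps_expansion_removable_quotient[OF this(1) asm(1,4) L]
    fps_expansion_removable_quotient[OF this(2) asm(1,4) L']
  obtain P where P: "fps_conv_radius P > 0" "fps_X ^ 1 * fps_expansion b z = P * A"
    using quotients(1) unfolding A_def fps_expansion_shift_power_mult[OF asm(2)] by blast
  obtain Q where Q: "fps_conv_radius Q > 0" "fps_X ^ 2 * fps_expansion c z = Q * A"
    using quotients(2) unfolding A_def fps_expansion_shift_power_mult[OF asm(3)] by blast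
  \<comment> \<open>A zero Taylor series would mean a zero germ; \<open>A\<close> can thus be
    cancelled in the integral domain of formal power series.\<close>
  have "A \<noteq> 0"
  proof
    assume "A = 0"
    hence "eventually (\<lambda>x. a (z + x) = 0) (nhds 0)"
      using analytic_at_imp_has_fps_expansion[OF asm(1)]
      by (simp add: A_def has_fps_expansion_0_iff)
    with asm(4) show False
      by (simp add: identically_zero_near_def nhds_to_0' eventually_filtermap)
  qed
  \<comment> \<open>Of the factor \<open>fps_X ^ 2\<close>, one \<open>fps_X\<close> goes to the
    series of \<open>b\<close> and one to \<open>fps_deriv y\<close>, while the series of
    \<open>c\<close> takes both. Then \<open>A\<close> divides every term.\<close>
  have "0 = fps_X ^ 2 * (A * fps_deriv (fps_deriv y) + fps_expansion b z * fps_deriv y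
      + fps_expansion c z * y)"
    using asm(6) by (simp add: formal_solution_def A_def)
  also have "\<dots> = A * (fps_X ^ 2 * fps_deriv (fps_deriv y))
      + (fps_X ^ 1 * fps_expansion b z) * (fps_X * fps_deriv y)
      + (fps_X ^ 2 * fps_expansion c z) * y"
    by (simp add: algebra_simps power2_eq_square)
  also have "\<dots> = A * (fps_X ^ 2 * fps_deriv (fps_deriv y) + P * (fps_X * fps_deriv y) + Q * y)"
    unfolding P Q by (simp add: algebra_simps)
  finally have "fps_X ^ 2 * fps_deriv (fps_deriv y) + P * (fps_X * fps_deriv y) + Q * y = 0"
    using \<open>A \<noteq> 0\<close> by simp
  from Fuchs_normal_form_conv_radius_pos[OF this P(1) Q(1)]
  show ?thesis by (simp add: convergent_fps_def)
qed

end
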